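(* Let $E$ be a Banach space and let $\tau$ be a Hausdorff topology on $E$. Let $\{ T(t) : t \geq 0 \}$ be a one-parameter $\tau$-continuous semigroup of nonexpansive mappings on a compact convex subset $C$ of $E$. Fix $\alpha, \beta > 0$ with $\alpha / \beta \notin \mathbb{Q}$ and $\kappa, \lambda \in (0,1)$. Define a sequence $\{ x_n \}$ in $C$ by $x_1 \in C$ and $$ x_{n+1} = \big( \lambda\, T(\alpha) + (1-\lambda)\, I \big) \circ \big( \kappa\, T(\beta) + (1-\kappa)\, I \big)^n x_n $$ for $n \in \mathbb{N}$, where $I$ is the identity mapping on $C$, sums and scalar multiples of mappings are taken pointwise, and the exponent $n$ denotes the $n$-fold iterate. Then $\{ x_n \}$ converges strongly to a common fixed point of $\{ T(t) : t \geq 0 \}$.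
   Context: $\mathbb{N}$ is the set of positive integers and $\mathbb{Q}$ the set of rational numbers. Compactness of $C$ and strong convergence refer to the norm topology. Let $C$ be a subset of a Banach space $E$ and let $\tau$ be a Hausdorff topology on $E$ (not necessarily the norm topology). A family $\{T(t) : t \geq 0\}$ of mappings from $C$ into $C$ is called a one-parameter $\tau$-continuous semigroup of nonexpansive mappings on $C$ if: (sg 1) $T(s+t) = T(s) \circ T(t)$ for all $s, t \geq 0$; (sg 2) for each $x \in C$, the mapping $t \mapsto T(t)x$ from $[0,\infty)$ into $C$ is continuous with respect to $\tau$; (sg 3) for each $t \geq 0$, $T(t)$ is nonexpansive, i.e., $\|T(t)x - T(t)y\| \leq \|x-y\|$ for all $x,y \in C$. (It is not required that $T(0)$ be the identity mapping.) A common fixed point of $\{T(t) : t \geq 0\}$ is a point $z \in C$ with $T(t)z = z$ for all $t \geq 0$. *)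

theory Defs
  imports "HOL-Analysis.Analysis"
begin

definition nonexpansive_on :: "'a::real_normed_vector set \<Rightarrow> ('a \<Rightarrow> 'a) \<Rightarrow> bool" where
  "nonexpansive_on C f \<longleftrightarrow> (\<forall>x\<in>C. \<forall>y\<in>C. norm (f x - f y) \<le> norm (x - y))"

text \<open>
  The family \<open>T\<close> is a total function; only its values \<open>T t x\<close> with \<open>t \<ge> 0\<close> and \<open>x \<in> C\<close>
  are constrained. \<open>T 0\<close> need not be the identity. The topology \<open>\<tau>\<close> is unrelated to the norm
  topology of the underlying type, hence an explicit \<open>topology\<close> value.
\<close>
definition nonexpansive_semigroup ::
  "'a::real_normed_vector topology \<Rightarrow> 'a set \<Rightarrow> (real \<Rightarrow> 'a \<Rightarrow> 'a) \<Rightarrow> bool" where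
  "nonexpansive_semigroup \<tau> C T \<longleftrightarrow>
     (\<forall>t\<ge>0. T t \<in> C \<rightarrow> C) \<and>
     (\<forall>s\<ge>0. \<forall>t\<ge>0. \<forall>x\<in>C. T (s + t) x = (T s \<circ> T t) x) \<and>
     (\<forall>x\<in>C. continuous_map (top_of_set {0..}) (subtopology \<tau> C) (\<lambda>t. T t x)) \<and>
     (\<forall>t\<ge>0. nonexpansive_on C (T t))"

definition common_fixed_point :: "'a set \<Rightarrow> (real \<Rightarrow> 'a \<Rightarrow> 'a) \<Rightarrow> 'a \<Rightarrow> bool" where
  "common_fixed_point C T z \<longleftrightarrow> z \<in> C \<and> (\<forall>t\<ge>0. T t z = z)"

definition averaged :: "real \<Rightarrow> ('a::real_vector \<Rightarrow> 'a) \<Rightarrow> 'a \<Rightarrow> 'a" where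
  "averaged c f = (\<lambda>x. c *\<^sub>R f x + (1 - c) *\<^sub>R id x)"

end

theory Submission
  imports Defs
begin

text \<open>
  For commuting nonexpansive maps, the Krasnoselskii iterates \<open>B\<^sup>n\<close> of \<open>\<kappa> T(\<beta>) + (1-\<kappa>) I\<close>
  converge on \<open>C\<close> to a nonexpansive retraction \<open>P\<close> onto the fixed points of \<open>T(\<beta>)\<close>. This set is not
  convex in general, but \<open>P \<circ> A\<close>, where \<open>A = \<mu> T(\<alpha>) + (1-\<mu>) I\<close>, still satisfies on it the metric
  inequality of a Krasnoselskii mean of \<open>T(\<alpha>)\<close>, so its iterates converge to a common fixed point of
  \<open>T(\<alpha>)\<close> and \<open>T(\<beta>)\<close>. Cluster points of the sequence are mapped to cluster points by \<open>A \<circ> P\<close>;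
  hence some cluster point is a common fixed point, and as the distance to it decreases, the
  whole sequence converges. The fixed times of a point are closed under addition and subtraction,
  so irrationality of \<open>\<alpha> / \<beta>\<close> makes them dense, and \<open>\<tau>\<close>-continuity makes them all of \<open>[0, \<infinity>)\<close>.
\<close>

subsection \<open>Krasnoselskii means in metric spaces\<close>

text \<open>A purely metric substitute for \<open>g = c f + (1 - c) I\<close>: the distance
  inequality is all that is kept of the convex combination. It makes sense on a set \<open>D\<close>
  that is not convex, and it survives composing \<open>g\<close> with a nonexpansive retraction onto
  \<open>D\<close>.\<close>

definition krasnoselskii_mean ::
  "'a::metric_space set \<Rightarrow> real \<Rightarrow> ('a \<Rightarrow> 'a) \<Rightarrow> ('a \<Rightarrow> 'a) \<Rightarrow> bool" where
  "krasnoselskii_mean D c f g \<longleftrightarrow>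
     f \<in> D \<rightarrow> D \<and> g \<in> D \<rightarrow> D \<and> 1-lipschitz_on D f \<and> 1-lipschitz_on D g \<and>
     (\<forall>p\<in>D. \<forall>x\<in>D. dist p (g x) \<le> c * dist p (f x) + (1 - c) * dist p x)"

lemma funpow_in_funcset: "g \<in> D \<rightarrow> D \<Longrightarrow> g ^^ n \<in> D \<rightarrow> D"
  by (induction n) auto

lemma lipschitz_on_funpow:
  assumes "1-lipschitz_on D g" "g \<in> D \<rightarrow> D"
  shows "1-lipschitz_on D (g ^^ n)"
proof (induction n)
  case 0
  then show ?case by (simp add: lipschitz_on_def)
next
  case (Suc n)
  have "(g ^^ n) ` D \<subseteq> D" using funpow_in_funcset[OF assms(2)] by blast
  then have "1-lipschitz_on ((g ^^ n) ` D) g"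
    using assms(1) lipschitz_on_subset by blast
  from lipschitz_on_compose[OF Suc this] show ?case by simp
qed

lemma lipschitz_on_1D: "\<lbrakk>1-lipschitz_on D f; x \<in> D; y \<in> D\<rbrakk> \<Longrightarrow> dist (f x) (f y) \<le> dist x y"
  using lipschitz_onD by fastforce

lemma krasnoselskii_meanD:
  assumes "krasnoselskii_mean D c f g"
  shows "f \<in> D \<rightarrow> D" "g \<in> D \<rightarrow> D" "1-lipschitz_on D f" "1-lipschitz_on D g"
    "\<And>p x. \<lbrakk>p \<in> D; x \<in> D\<rbrakk> \<Longrightarrow> dist p (g x) \<le> c * dist p (f x) + (1 - c) * dist p x"
  using assms unfolding krasnoselskii_mean_def by blast+

lemma krasnoselskii_mean_fixed_point:
  assumes "krasnoselskii_mean D c f g" "z \<in> D" "f z = z"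
  shows "g z = z"
  using krasnoselskii_meanD(5)[OF assms(1,2,2)] assms(3) by simp

text \<open>Testing the inequality with \<open>p = x\<close> and with \<open>p = f x\<close> puts
  \<open>g x\<close> within the fractions \<open>c\<close> and \<open>1 - c\<close> of the
  displacement from \<open>x\<close> and \<open>f x\<close>. Nonexpansiveness of \<open>f\<close>
  then makes the displacement decrease along orbits of \<open>g\<close>.\<close>

lemma krasnoselskii_mean_displacement:
  assumes km: "krasnoselskii_mean D c f g" and x: "x \<in> D" and c: "0 < c"
  shows "dist x (g x) \<le> c * dist x (f x)"
    and "dist (g x) (f (g x)) \<le> dist x (f x)"
proof -
  note km = krasnoselskii_meanD[OF km]
  have fx: "f x \<in> D" and gx: "g x \<in> D" using km(1,2) x by auto
  show 1: "dist x (g x) \<le> c * dist x (f x)" using km(5)[OF x x] by simp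
  have 2: "dist (f x) (g x) \<le> (1 - c) * dist (f x) x" using km(5)[OF fx x] by simp
  have "dist (g x) (f (g x)) \<le> dist (g x) (f x) + dist (f x) (f (g x))"
    by (rule dist_triangle)
  also have "dist (f x) (f (g x)) \<le> dist x (g x)"
    using lipschitz_on_1D[OF km(3) x gx] .
  finally show "dist (g x) (f (g x)) \<le> dist x (f x)"
    using 1 2 by (simp add: dist_commute algebra_simps)
qed

text \<open>The Goebel--Kirk inequality in the case of constant displacement; unless \<open>r = 0\<close> it makes the
  orbit of \<open>u\<close> unbounded.\<close>

lemma krasnoselskii_mean_constant_displacement:
  assumes km: "krasnoselskii_mean D c f g" and u: "u \<in> D" and c: "0 < c" "c < 1"
    and r: "\<And>n. dist ((g ^^ n) u) (f ((g ^^ n) u)) = r"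
  shows "(1 + real n * c) * r \<le> dist ((g ^^ i) u) (f ((g ^^ (i + n)) u))"
proof (induction n arbitrary: i)
  case 0
  then show ?case using r by simp
next
  case (Suc n)
  note kmD = krasnoselskii_meanD[OF km]
  have inD: "(g ^^ k) u \<in> D" for k using funpow_in_funcset[OF kmD(2)] u by blast
  have step: "dist ((g ^^ i) u) ((g ^^ (i + k)) u) \<le> real k * (c * r)" for k
  proof (induction k)
    case (Suc k)
    have "dist ((g ^^ (i + k)) u) ((g ^^ Suc (i + k)) u) \<le> c * r"
      using krasnoselskii_mean_displacement(1)[OF km inD c(1)] r by simp
    with Suc dist_triangle[of "(g ^^ i) u" "(g ^^ (i + Suc k)) u" "(g ^^ (i + k)) u"]
    show ?case by (simp add: algebra_simps)
  qed simp
  \<comment> \<open>With the image of the far end as test point, the induction hypothesis at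
    \<open>Suc i\<close> bounds the left side of the mean inequality from below. Solving for the
    distance to \<open>(g ^^ i) u\<close> uses
    \<open>(1 + n c) - (n + 1) c^2 = (1 - c) (1 + (n + 1) c)\<close>.\<close>
  let ?p = "f ((g ^^ (i + Suc n)) u)"
  have p: "?p \<in> D" using inD kmD(1) by blast
  have "(1 + real n * c) * r \<le> dist ((g ^^ Suc i) u) ?p"
    using Suc[of "Suc i"] by simp
  also have "\<dots> \<le> c * dist ?p (f ((g ^^ i) u)) + (1 - c) * dist ?p ((g ^^ i) u)"
    using kmD(5)[OF p inD[of i]] by (simp add: dist_commute)
  also have "dist ?p (f ((g ^^ i) u)) \<le> real (Suc n) * (c * r)"
    using lipschitz_on_1D[OF kmD(3) inD[of "i + Suc n"] inD[of i]] step[of "Suc n"]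
    by (simp add: dist_commute)
  finally have "(1 - c) * ((1 + real (Suc n) * c) * r) \<le> (1 - c) * dist ?p ((g ^^ i) u)"
    using c by (simp add: algebra_simps)
  then show ?case using c by (simp add: dist_commute)
qed

text \<open>The displacement decreases to some \<open>r\<close> along the orbit, so all iterates of
  a cluster point \<open>u\<close> have displacement exactly \<open>r\<close>; boundedness of
  \<open>D\<close> forces \<open>r = 0\<close>. Since \<open>g\<close> then fixes \<open>u\<close>,
  distances to \<open>u\<close> decrease and the whole orbit converges.\<close>

theorem krasnoselskii_mean_iterates_converge:
  fixes D :: "'a::metric_space set"
  assumes km: "krasnoselskii_mean D c f g" and D: "compact D" and c: "0 < c" "c < 1" and x: "x \<in> D"
  obtains u where "u \<in> D" "f u = u" "(\<lambda>n. (g ^^ n) x) \<longlonglongrightarrow> u"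
proof -
  note kmD = krasnoselskii_meanD[OF km]
  have inD: "(g ^^ k) v \<in> D" if "v \<in> D" for k v
    using funpow_in_funcset[OF kmD(2)] that by blast
  define d where "d v = dist v (f v)" for v
  have cont_d: "continuous_on D d"
    unfolding d_def using kmD(3) by (intro continuous_intros lipschitz_on_continuous_on)
  have "decseq (\<lambda>n. d ((g ^^ n) x))"
    unfolding d_def using krasnoselskii_mean_displacement(2)[OF km inD[OF x] c(1)]
    by (intro decseq_SucI) simp
  from decseq_convergent[OF this, of 0]
  obtain r where r: "(\<lambda>n. d ((g ^^ n) x)) \<longlonglongrightarrow> r" by (auto simp: d_def)
  obtain u s where u: "u \<in> D" "strict_mono s" and us: "(\<lambda>k. (g ^^ s k) x) \<longlonglongrightarrow> u"
    using D[unfolded compact_def, rule_format, of "\<lambda>n. (g ^^ n) x"] inD[OF x]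
    by (auto simp: comp_def)
  \<comment> \<open>The displacements at times \<open>n + s k\<close> have two limits: one by
    continuity of \<open>d\<close> and \<open>g ^^ n\<close>, the other as a subsequence of a
    convergent sequence.\<close>
  have du: "d ((g ^^ n) u) = r" for n
  proof (rule LIMSEQ_unique)
    have "continuous_on D (g ^^ n)"
      using lipschitz_on_funpow[OF kmD(4,2)] by (rule lipschitz_on_continuous_on)
    then have "continuous_on D (\<lambda>v. d ((g ^^ n) v))"
      using inD by (intro continuous_on_compose2[OF cont_d]) auto
    from continuous_on_tendsto_compose[OF this us u(1)]
    show "(\<lambda>k. d ((g ^^ (n + s k)) x)) \<longlonglongrightarrow> d ((g ^^ n) u)"
      using inD[OF x] by (simp add: funpow_add)
    have "strict_mono (\<lambda>k. n + s k)" using u(2) by (simp add: strict_mono_def)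
    from LIMSEQ_subseq_LIMSEQ[OF r this] show "(\<lambda>k. d ((g ^^ (n + s k)) x)) \<longlonglongrightarrow> r"
      by (simp add: comp_def)
  qed
  have "r = 0"
  proof (rule ccontr)
    assume "r \<noteq> 0"
    with du[of 0] have "r > 0" by (auto simp: d_def)
    obtain M where M: "\<And>a b. \<lbrakk>a \<in> D; b \<in> D\<rbrakk> \<Longrightarrow> dist a b \<le> M"
      using compact_imp_bounded[OF D] by (metis diameter_bounded_bound)
    have bd: "(1 + real n * c) * r \<le> M" for n
      using krasnoselskii_mean_constant_displacement[OF km u(1) c, of r n 0]
        M[OF u(1), of "f ((g ^^ n) u)"] inD[OF u(1), of n] kmD(1) du
      by (fastforce simp: d_def)
    obtain n where "M < real n * (c * r)"
      using reals_Archimedean3[of "c * r"] c \<open>r > 0\<close> by auto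
    with bd[of n] \<open>r > 0\<close> show False by (simp add: algebra_simps)
  qed
  with du[of 0] have fu: "f u = u" by (simp add: d_def)
  have gu: "g u = u" using krasnoselskii_mean_fixed_point[OF km u(1) fu] .
  have "decseq (\<lambda>n. dist ((g ^^ n) x) u)"
    using lipschitz_on_1D[OF kmD(4) inD[OF x] u(1)] gu by (intro decseq_SucI) simp
  from decseq_convergent[OF this, of 0]
  obtain l where l: "(\<lambda>n. dist ((g ^^ n) x) u) \<longlonglongrightarrow> l" by auto
  have "(\<lambda>k. dist ((g ^^ s k) x) u) \<longlonglongrightarrow> 0"
    using us by (simp flip: tendsto_dist_iff)
  moreover have "(\<lambda>k. dist ((g ^^ s k) x) u) \<longlonglongrightarrow> l"
    using LIMSEQ_subseq_LIMSEQ[OF l u(2)] by (simp add: comp_def)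
  ultimately have "l = 0" using LIMSEQ_unique by blast
  with l have "(\<lambda>n. (g ^^ n) x) \<longlonglongrightarrow> u" by (simp flip: tendsto_dist_iff)
  with u(1) fu show thesis by (rule that)
qed

subsection \<open>Two commuting nonexpansive mappings\<close>

text \<open>Indexing starts at 0, so \<open>y n\<close> stands for the term \<open>n + 1\<close> of
  the original sequence and the exponent is \<open>Suc n\<close>.\<close>

theorem alternating_iteration_converges:
  fixes C :: "'a::metric_space set"
  assumes C: "compact C" and c: "0 < c" "c < 1" and e: "0 < e" "e < 1"
    and A: "krasnoselskii_mean C c S A" and B: "krasnoselskii_mean C e R B"
    and comm: "\<And>v. v \<in> C \<Longrightarrow> S (R v) = R (S v)"
    and y0: "y 0 \<in> C" and y: "\<And>n. y (Suc n) = A ((B ^^ Suc n) (y n))"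
  obtains z where "z \<in> C" "S z = z" "R z = z" "y \<longlonglongrightarrow> z"
proof -
  note AD = krasnoselskii_meanD[OF A] and BD = krasnoselskii_meanD[OF B]
  have BC: "(B ^^ n) v \<in> C" if "v \<in> C" for n v
    using funpow_in_funcset[OF BD(2)] that by blast
  have yC: "y n \<in> C" for n
    using y0 y AD(2) BC[of _ "Suc _"] by (induction n) fastforce+
  have "\<forall>v\<in>C. \<exists>w. w \<in> C \<and> R w = w \<and> (\<lambda>n. (B ^^ n) v) \<longlonglongrightarrow> w"
    using krasnoselskii_mean_iterates_converge[OF B C e] by metis
  then obtain P where P: "\<And>v. v \<in> C \<Longrightarrow> P v \<in> C" "\<And>v. v \<in> C \<Longrightarrow> R (P v) = P v"
      "\<And>v. v \<in> C \<Longrightarrow> (\<lambda>n. (B ^^ n) v) \<longlonglongrightarrow> P v"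
    by metis
  have P_fix: "P v = v" if "v \<in> C" "R v = v" for v
  proof -
    have "B v = v" using krasnoselskii_mean_fixed_point[OF B that] .
    then have "(B ^^ n) v = v" for n by (induction n) auto
    then show ?thesis using P(3)[OF that(1)] LIMSEQ_const_iff[of v "P v"] by simp
  qed
  have P_lip: "dist (P v) (P w) \<le> dist v w" if "v \<in> C" "w \<in> C" for v w
  proof (rule LIMSEQ_le_const2)
    show "(\<lambda>n. dist ((B ^^ n) v) ((B ^^ n) w)) \<longlonglongrightarrow> dist (P v) (P w)"
      using P(3) that by (intro tendsto_dist)
    show "\<exists>N. \<forall>n\<ge>N. dist ((B ^^ n) v) ((B ^^ n) w) \<le> dist v w"
      using lipschitz_on_1D[OF lipschitz_on_funpow[OF BD(4,2)]] that by blast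
  qed
  define F where "F = {v \<in> C. R v = v}"
  have "continuous_on C (\<lambda>v. dist v (R v))"
    using BD(3) by (intro continuous_intros lipschitz_on_continuous_on)
  from continuous_closed_preimage_constant[OF this compact_imp_closed[OF C], of 0]
  have "closed {v \<in> C. dist v (R v) = 0}" .
  moreover have "{v \<in> C. dist v (R v) = 0} = F" by (auto simp: F_def)
  ultimately have "closed F" by simp
  then have F: "compact F"
    using compact_Int_closed[OF C, of F] by (simp add: F_def Collect_conj_eq)
  \<comment> \<open>Commutation makes \<open>F\<close> invariant under \<open>S\<close>. As
    \<open>P\<close> is nonexpansive and fixes each \<open>p\<close> in \<open>F\<close>,
    \<open>P (A v)\<close> is no farther from \<open>p\<close> than \<open>A v\<close>, so the
    inequality is inherited from \<open>A\<close>.\<close>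
  have Q: "krasnoselskii_mean F c S (\<lambda>v. P (A v))"
    unfolding krasnoselskii_mean_def
  proof (intro conjI ballI)
    have FC: "F \<subseteq> C" by (auto simp: F_def)
    show "S \<in> F \<rightarrow> F" using comm AD(1) by (fastforce simp: F_def)
    show "(\<lambda>v. P (A v)) \<in> F \<rightarrow> F" using P AD(2) by (auto simp: F_def)
    show "1-lipschitz_on F S" using AD(3) FC lipschitz_on_subset by blast
    show "1-lipschitz_on F (\<lambda>v. P (A v))"
    proof (rule lipschitz_onI)
      fix v w assume "v \<in> F" "w \<in> F"
      with FC have vw: "v \<in> C" "w \<in> C" by auto
      then have "A v \<in> C" "A w \<in> C" using AD(2) by auto
      from P_lip[OF this] lipschitz_on_1D[OF AD(4) vw]
      show "dist (P (A v)) (P (A w)) \<le> 1 * dist v w" by simp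
    qed simp
    fix p v assume "p \<in> F" "v \<in> F"
    then have pv: "p \<in> C" "v \<in> C" "P p = p" using P_fix by (auto simp: F_def)
    then have "A v \<in> C" using AD(2) by auto
    then have "dist p (P (A v)) \<le> dist p (A v)" using P_lip[OF pv(1)] pv(3) by metis
    also note AD(5)[OF pv(1,2)]
    finally show "dist p (P (A v)) \<le> c * dist p (S v) + (1 - c) * dist p v" .
  qed
  define L where "L = {v. \<exists>s. strict_mono s \<and> (y \<circ> s) \<longlonglongrightarrow> v}"
  have LC: "v \<in> C" if "v \<in> L" for v
  proof -
    obtain s where "(y \<circ> s) \<longlonglongrightarrow> v" using \<open>v \<in> L\<close> by (auto simp: L_def)
    then show ?thesis
      using closed_sequentially[OF compact_imp_closed[OF C], of "y \<circ> s" v] yC by simp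
  qed
  \<comment> \<open>If \<open>y (s k)\<close> tends to \<open>v\<close>, the exponents
    \<open>Suc (s k)\<close> grow as well. Nonexpansive powers of \<open>B\<close> allow
    \<open>y (s k)\<close> to be replaced by \<open>v\<close>, whose iterates tend to
    \<open>P v\<close>.\<close>
  have LAP: "A (P v) \<in> L" if "v \<in> L" for v
  proof -
    obtain s where s: "strict_mono s" "(y \<circ> s) \<longlonglongrightarrow> v"
      using \<open>v \<in> L\<close> by (auto simp: L_def)
    have v: "v \<in> C" using LC that .
    let ?s = "\<lambda>k. Suc (s k)"
    have "strict_mono ?s" using s(1) by (simp add: strict_mono_def)
    moreover have "(\<lambda>k. dist (y (?s k)) (A (P v))) \<longlonglongrightarrow> 0"
    proof (rule tendsto_sandwich[OF _ _ tendsto_const])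
      show "\<forall>\<^sub>F k in sequentially. dist (y (?s k)) (A (P v))
          \<le> dist (y (s k)) v + dist ((B ^^ ?s k) v) (P v)"
      proof (intro always_eventually allI)
        fix k
        have "dist (y (?s k)) (A (P v)) \<le> dist ((B ^^ ?s k) (y (s k))) (P v)"
          unfolding y using lipschitz_on_1D[OF AD(4) BC[OF yC] P(1)[OF v]] .
        also have "\<dots> \<le> dist ((B ^^ ?s k) (y (s k))) ((B ^^ ?s k) v) + dist ((B ^^ ?s k) v) (P v)"
          by (rule dist_triangle)
        also have "dist ((B ^^ ?s k) (y (s k))) ((B ^^ ?s k) v) \<le> dist (y (s k)) v"
          using lipschitz_on_1D[OF lipschitz_on_funpow[OF BD(4,2)] yC v] .
        finally show "dist (y (?s k)) (A (P v))
          \<le> dist (y (s k)) v + dist ((B ^^ ?s k) v) (P v)" by simp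
      qed
      have "(\<lambda>k. dist (y (s k)) v) \<longlonglongrightarrow> 0"
        using s(2) tendsto_dist_iff[of "y \<circ> s"] by (simp add: comp_def)
      moreover have "(\<lambda>k. dist ((B ^^ ?s k) v) (P v)) \<longlonglongrightarrow> 0"
        using LIMSEQ_subseq_LIMSEQ[OF P(3)[OF v] \<open>strict_mono ?s\<close>] tendsto_dist_iff
        by (fastforce simp: comp_def)
      ultimately show "(\<lambda>k. dist (y (s k)) v + dist ((B ^^ ?s k) v) (P v)) \<longlonglongrightarrow> 0"
        using tendsto_add_zero by blast
    qed simp
    ultimately show ?thesis
      unfolding L_def comp_def using tendsto_dist_iff by blast
  qed
  obtain u where u: "u \<in> L"
    using C[unfolded compact_def, rule_format, of y] yC by (auto simp: L_def)
  then have "P u \<in> F" using P LC by (auto simp: F_def)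
  from krasnoselskii_mean_iterates_converge[OF Q F c this]
  obtain z where "z \<in> F" and Sz: "S z = z" and z_lim: "(\<lambda>n. ((\<lambda>v. P (A v)) ^^ n) (P u)) \<longlonglongrightarrow> z" .
  then have z: "z \<in> C" "R z = z" by (auto simp: F_def)
  have Az: "A z = z" using krasnoselskii_mean_fixed_point[OF A z(1) Sz] .
  have Bz: "(B ^^ n) z = z" for n
    using krasnoselskii_mean_fixed_point[OF B z] by (induction n) auto
  \<comment> \<open>Each point of the orbit converging to \<open>z\<close> is lifted to a cluster
    point of \<open>y\<close>; replacing \<open>v\<close> by \<open>A (P v)\<close> advances the
    orbit by one step.\<close>
  have "\<exists>v\<in>L. P v = ((\<lambda>v. P (A v)) ^^ n) (P u)" for n
  proof (induction n)
    case (Suc n)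
    then show ?case using LAP by fastforce
  qed (use u in auto)
  then obtain v where v: "\<And>n. v n \<in> L" "\<And>n. P (v n) = ((\<lambda>v. P (A v)) ^^ n) (P u)"
    by metis
  have "decseq (\<lambda>n. dist (y n) z)"
  proof (rule decseq_SucI)
    fix n
    have "dist (y (Suc n)) z \<le> dist ((B ^^ Suc n) (y n)) z"
      unfolding y using lipschitz_on_1D[OF AD(4) BC[OF yC] z(1)] Az by metis
    also have "\<dots> \<le> dist (y n) z"
      using lipschitz_on_1D[OF lipschitz_on_funpow[OF BD(4,2)] yC z(1)] Bz by metis
    finally show "dist (y (Suc n)) z \<le> dist (y n) z" .
  qed
  from decseq_convergent[OF this, of 0]
  obtain l where l: "(\<lambda>n. dist (y n) z) \<longlonglongrightarrow> l" by auto
  have dL: "dist w z = l" if "w \<in> L" for w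
  proof -
    obtain s where s: "strict_mono s" "(y \<circ> s) \<longlonglongrightarrow> w"
      using \<open>w \<in> L\<close> by (auto simp: L_def)
    have "(\<lambda>k. dist (y (s k)) z) \<longlonglongrightarrow> dist w z"
      using s(2) by (intro tendsto_dist tendsto_const) (simp add: comp_def)
    moreover have "(\<lambda>k. dist (y (s k)) z) \<longlonglongrightarrow> l"
      using LIMSEQ_subseq_LIMSEQ[OF l s(1)] by (simp add: comp_def)
    ultimately show ?thesis using LIMSEQ_unique by blast
  qed
  \<comment> \<open>All cluster points lie at the same distance \<open>l\<close> from
    \<open>z\<close>, in particular \<open>A (P (v n))\<close>; but \<open>P (v n)\<close> tends to
    \<open>z\<close>, which forces \<open>l = 0\<close>.\<close>
  have "l \<le> dist (P (v n)) z" for n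
  proof -
    have "dist (A (P (v n))) (A z) \<le> dist (P (v n)) z"
      using lipschitz_on_1D[OF AD(4) P(1)[OF LC[OF v(1)]] z(1)] .
    with dL[OF LAP[OF v(1)]] Az show ?thesis by simp
  qed
  moreover have "(\<lambda>n. dist (P (v n)) z) \<longlonglongrightarrow> 0"
    using z_lim by (simp add: v(2) flip: tendsto_dist_iff)
  ultimately have "l \<le> 0" by (intro LIMSEQ_le_const) auto
  moreover have "l \<ge> 0" using l by (rule LIMSEQ_le_const) simp
  ultimately have "y \<longlonglongrightarrow> z" using l by (simp flip: tendsto_dist_iff)
  with z(1) Sz z(2) show thesis by (rule that)
qed

subsection \<open>Averaged mappings and semigroups\<close>

lemma nonexpansive_on_iff_lipschitz: "nonexpansive_on C f \<longleftrightarrow> 1-lipschitz_on C f"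
  by (auto simp: nonexpansive_on_def lipschitz_on_def dist_norm)

lemma dist_convex_combination_le:
  fixes p q v w :: "'a::real_normed_vector"
  assumes "0 \<le> c" "c \<le> 1"
  shows "dist (c *\<^sub>R p + (1 - c) *\<^sub>R q) (c *\<^sub>R v + (1 - c) *\<^sub>R w) \<le> c * dist p v + (1 - c) * dist q w"
proof -
  have "(c *\<^sub>R p + (1 - c) *\<^sub>R q) - (c *\<^sub>R v + (1 - c) *\<^sub>R w) = c *\<^sub>R (p - v) + (1 - c) *\<^sub>R (q - w)"
    by (simp add: algebra_simps)
  with norm_triangle_ineq[of "c *\<^sub>R (p - v)" "(1 - c) *\<^sub>R (q - w)"] assms
  show ?thesis by (simp add: dist_norm)
qed

lemma krasnoselskii_mean_averaged:
  assumes "convex C" "f \<in> C \<rightarrow> C" "nonexpansive_on C f" "c \<in> {0<..<1}"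
  shows "krasnoselskii_mean C c f (averaged c f)"
proof -
  have c: "0 \<le> c" "c \<le> 1" using assms(4) by auto
  have f: "1-lipschitz_on C f" using assms(3) by (simp add: nonexpansive_on_iff_lipschitz)
  show ?thesis
    unfolding krasnoselskii_mean_def
  proof (intro conjI ballI)
    show "averaged c f \<in> C \<rightarrow> C"
      using assms(1,2) c by (auto simp: averaged_def intro!: convexD)
    show "1-lipschitz_on C (averaged c f)"
    proof (rule lipschitz_onI)
      fix v w assume vw: "v \<in> C" "w \<in> C"
      have "dist (averaged c f v) (averaged c f w) \<le> c * dist (f v) (f w) + (1 - c) * dist v w"
        using dist_convex_combination_le[OF c] by (simp add: averaged_def)
      also have "c * dist (f v) (f w) \<le> c * dist v w"
        using lipschitz_on_1D[OF f vw] c by (intro mult_left_mono)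
      finally show "dist (averaged c f v) (averaged c f w) \<le> 1 * dist v w"
        by (simp add: algebra_simps)
    qed simp
    show "dist p (averaged c f v) \<le> c * dist p (f v) + (1 - c) * dist p v" for p v
      using dist_convex_combination_le[OF c, of p p "f v" v]
      by (simp add: averaged_def flip: scaleR_left_distrib)
  qed (use assms f in auto)
qed

section \<open>Incommensurable times: Diophantine approximation and density\<close>

lemma irrational_combination_small:
  fixes \<alpha> \<beta> :: real
  assumes "\<alpha> > 0" "\<beta> > 0" "\<alpha> / \<beta> \<notin> \<rat>" "0 < \<epsilon>"
  obtains m n :: nat where "\<bar>real m * \<alpha> - real n * \<beta>\<bar> < \<epsilon>" "real m * \<alpha> \<noteq> real n * \<beta>"
proof -
  obtain N :: nat where N: "N > 0" "1 / real N < \<epsilon> / \<beta>"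
    using reals_Archimedean[of "\<epsilon> / \<beta>"] assms
    by (metis divide_pos_pos inverse_eq_divide zero_less_Suc)
  obtain h k where hk: "0 < k" "\<bar>of_int k * (\<alpha> / \<beta>) - of_int h\<bar> < 1 / real N"
    using Dirichlet_approx[OF N(1)] by metis
  \<comment> \<open>Dirichlet's theorem yields integers. A negative \<open>h\<close> would make the
    error exceed 1, so both coefficients can be taken as naturals.\<close>
  have "h \<ge> 0"
  proof (rule ccontr)
    assume "\<not> h \<ge> 0"
    then have "of_int h \<le> (-1::real)" by linarith
    moreover have "of_int k * (\<alpha> / \<beta>) > 0" using hk(1) assms by simp
    moreover have "1 / real N \<le> 1" using N(1) by simp
    ultimately show False using hk(2) by linarith
  qed
  have eq: "real (nat k) * \<alpha> - real (nat h) * \<beta> = (of_int k * (\<alpha> / \<beta>) - of_int h) * \<beta>"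
    using \<open>h \<ge> 0\<close> hk(1) assms(2) by (simp add: field_simps)
  have "\<bar>of_int k * (\<alpha> / \<beta>) - of_int h\<bar> < \<epsilon> / \<beta>" using hk(2) N(2) by linarith
  then have "\<bar>real (nat k) * \<alpha> - real (nat h) * \<beta>\<bar> < \<epsilon>"
    unfolding eq abs_mult using assms(2) by (simp add: pos_less_divide_eq)
  moreover have "real (nat k) * \<alpha> \<noteq> real (nat h) * \<beta>"
  proof
    assume "real (nat k) * \<alpha> = real (nat h) * \<beta>"
    then have "\<alpha> / \<beta> = of_int h / of_int k"
      using \<open>h \<ge> 0\<close> hk(1) assms(2) by (simp add: field_simps)
    with assms(3) show False by simp
  qed
  ultimately show thesis by (rule that)
qed

text \<open>\<open>G\<close> contains arbitrarily small positive \<open>\<delta>\<close>, namely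
  differences of multiples of \<alpha> and \<beta>; the multiples of \<open>\<delta>\<close> come
  within \<open>\<delta>\<close> of every nonnegative time, and closedness finishes.\<close>

lemma closed_subsemigroup_eq_nonneg:
  fixes G :: "real set"
  assumes cl: "closed G"
    and add: "\<And>s t. \<lbrakk>s \<in> G; t \<in> G\<rbrakk> \<Longrightarrow> s + t \<in> G"
    and diff: "\<And>s t. \<lbrakk>s \<in> G; t \<in> G; s \<le> t\<rbrakk> \<Longrightarrow> t - s \<in> G"
    and G: "\<alpha> \<in> G" "\<beta> \<in> G" and pos: "\<alpha> > 0" "\<beta> > 0" and irr: "\<alpha> / \<beta> \<notin> \<rat>"
  shows "{0..} \<subseteq> G"
proof
  fix t :: real assume "t \<in> {0..}"
  have mult: "real n * s \<in> G" if "s \<in> G" for n s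
  proof (induction n)
    case 0
    then show ?case using diff[OF that that] by simp
  next
    case (Suc n)
    then show ?case using add[OF that Suc] by (simp add: algebra_simps)
  qed
  have "\<exists>s\<in>G. dist s t < \<epsilon>" if "\<epsilon> > 0" for \<epsilon>
  proof -
    obtain m n :: nat where mn: "\<bar>real m * \<alpha> - real n * \<beta>\<bar> < \<epsilon>" "real m * \<alpha> \<noteq> real n * \<beta>"
      using irrational_combination_small[OF pos irr \<open>\<epsilon> > 0\<close>] .
    define \<delta> where "\<delta> = \<bar>real m * \<alpha> - real n * \<beta>\<bar>"
    have \<delta>: "0 < \<delta>" "\<delta> < \<epsilon>" using mn by (auto simp: \<delta>_def)
    have "\<delta> \<in> G"
      using diff[OF mult[OF G(1), of m] mult[OF G(2), of n]]
        diff[OF mult[OF G(2), of n] mult[OF G(1), of m]]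
      by (cases "real m * \<alpha> \<le> real n * \<beta>") (auto simp: \<delta>_def abs_if)
    define k where "k = nat \<lfloor>t / \<delta>\<rfloor>"
    have "0 \<le> t / \<delta>" using \<open>t \<in> {0..}\<close> \<delta> by simp
    then have "real k \<le> t / \<delta>" "t / \<delta> < real k + 1" unfolding k_def by linarith+
    then have "real k * \<delta> \<le> t" "t < real k * \<delta> + \<delta>" using \<delta> by (simp_all add: field_simps)
    then have "dist (real k * \<delta>) t < \<epsilon>" using \<delta> by (simp add: dist_real_def)
    with mult[OF \<open>\<delta> \<in> G\<close>] show ?thesis by blast
  qed
  then have "t \<in> closure G" by (simp add: closure_approachable)
  with cl show "t \<in> G" by simp
qed

section \<open>From two fixed times to all times\<close>

lemma nonexpansive_semigroup_common_fixed_point: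
  assumes sg: "nonexpansive_semigroup \<tau> C T" and H: "Hausdorff_space \<tau>"
    and z: "z \<in> C" "T \<alpha> z = z" "T \<beta> z = z"
    and pos: "\<alpha> > 0" "\<beta> > 0" and irr: "\<alpha> / \<beta> \<notin> \<rat>"
  shows "common_fixed_point C T z"
proof -
  have plus: "T (s + t) z = T s (T t z)" if "s \<ge> 0" "t \<ge> 0" for s t
    using sg z(1) that by (simp add: nonexpansive_semigroup_def)
  have cont: "continuous_map (top_of_set {0..}) (subtopology \<tau> C) (\<lambda>t. T t z)"
    using sg z(1) by (simp add: nonexpansive_semigroup_def)
  define G where "G = {t \<in> {0..}. T t z = z}"
  \<comment> \<open>Closedness of the singleton needs \<open>z\<close> in the space; this holds
    because \<open>z\<close> equals \<open>T \<alpha> z\<close>, a value of the continuous orbit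
    map.\<close>
  have "T \<alpha> z \<in> topspace (subtopology \<tau> C)"
    using funcset_mem[OF continuous_map_funspace[OF cont], of \<alpha>] pos(1) by simp
  with z(2) have "z \<in> topspace (subtopology \<tau> C)" by simp
  then have "closedin (subtopology \<tau> C) {z}"
    using H by (intro closedin_Hausdorff_singleton Hausdorff_space_subtopology)
  from closedin_continuous_map_preimage[OF cont this]
  have "closedin (top_of_set {0..}) G" by (simp add: G_def)
  then have "closed G" using closedin_closed_trans closed_atLeast by blast
  then have "{0..} \<subseteq> G"
  proof (rule closed_subsemigroup_eq_nonneg[OF _ _ _ _ _ pos irr])
    show "s + t \<in> G" if "s \<in> G" "t \<in> G" for s t
      using that plus by (simp add: G_def)
    \<comment> \<open>Here \<open>T (t - s) z = T (t - s) (T s z) = T t z = z\<close>. The case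
      \<open>s = t\<close> covers time 0, although \<open>T 0\<close> need not be the
      identity.\<close>
    show "t - s \<in> G" if "s \<in> G" "t \<in> G" "s \<le> t" for s t
      using that plus[of "t - s" s] by (simp add: G_def)
  qed (use z pos in \<open>auto simp: G_def\<close>)
  then show ?thesis using z(1) by (auto simp: G_def common_fixed_point_def)
qed

theorem theorem9:
  fixes \<tau> :: "'a::banach topology"
    and C :: "'a set"
    and T :: "real \<Rightarrow> 'a \<Rightarrow> 'a"
    and \<alpha> \<beta> \<kappa> \<mu> :: real
    and x :: "nat \<Rightarrow> 'a"
  assumes "topspace \<tau> = UNIV" and "Hausdorff_space \<tau>"
    and "compact C" and "convex C"
    and "nonexpansive_semigroup \<tau> C T"
    and "\<alpha> > 0" and "\<beta> > 0" and "\<alpha> / \<beta> \<notin> \<rat>"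
    and "\<kappa> \<in> {0<..<1}" and "\<mu> \<in> {0<..<1}"
    and "x 1 \<in> C"
    and "\<And>n. n \<ge> 1 \<Longrightarrow>
           x (n + 1) = (averaged \<mu> (T \<alpha>) \<circ> (averaged \<kappa> (T \<beta>) ^^ n)) (x n)"
  shows "\<exists>z. common_fixed_point C T z \<and> x \<longlonglongrightarrow> z"
proof -
  have T: "T t \<in> C \<rightarrow> C" "nonexpansive_on C (T t)" if "t \<ge> 0" for t
    using assms(5) that by (auto simp: nonexpansive_semigroup_def)
  have mean: "krasnoselskii_mean C c (T t) (averaged c (T t))" if "t > 0" "c \<in> {0<..<1}" for c t
    using krasnoselskii_mean_averaged[OF assms(4)] T that by simp
  have comm: "T \<alpha> (T \<beta> v) = T \<beta> (T \<alpha> v)" if "v \<in> C" for v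
  proof -
    have "T (s + t) v = T s (T t v)" if "s \<ge> 0" "t \<ge> 0" for s t
      using assms(5) that \<open>v \<in> C\<close> by (simp add: nonexpansive_semigroup_def)
    from this[of \<alpha> \<beta>] this[of \<beta> \<alpha>] show ?thesis using assms(6,7) by (simp add: add.commute)
  qed
  have "0 < \<mu>" "\<mu> < 1" "0 < \<kappa>" "\<kappa> < 1" using assms(9,10) by auto
  \<comment> \<open>The recursion starts at index 1 and leaves \<open>x 0\<close> arbitrary, so the
    metric theorem is applied to the shifted sequence.\<close>
  moreover have "x (Suc (Suc n)) = averaged \<mu> (T \<alpha>) ((averaged \<kappa> (T \<beta>) ^^ Suc n) (x (Suc n)))" for n
    using assms(12)[of "Suc n"] by simp
  ultimately obtain z where z: "z \<in> C" "T \<alpha> z = z" "T \<beta> z = z" "(\<lambda>n. x (Suc n)) \<longlonglongrightarrow> z"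
    using alternating_iteration_converges[where y = "\<lambda>n. x (Suc n)" and S = "T \<alpha>" and R = "T \<beta>"
        and A = "averaged \<mu> (T \<alpha>)" and B = "averaged \<kappa> (T \<beta>)", OF assms(3) _ _ _ _
        mean[OF assms(6,10)] mean[OF assms(7,9)] comm] assms(11) by auto
  then show ?thesis
    using nonexpansive_semigroup_common_fixed_point[OF assms(5,2) z(1-3) assms(6-8)]
      LIMSEQ_imp_Suc by blast
qed

end
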